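(* Suppose that $\mathbb P^{X,Y} = \mathbb P^{g^{*}(Z,Y),Y}$ for some $g^{*} \in \mathcal G^c(d_Z,d_Y,D,d_g,\beta,K)$. Suppose that, for some $\gamma\ge1$ and with $a_n=n^{-\frac{2\gamma}{2\gamma+d+d_Y}}$, the critic network class satisfies $F\ge1$, $L_f\ge\log_2(n)\log_2(4(d+d_Y)\vee4\gamma)$, $\min_{i=1,\dots,L_f}p_{f,i}\gtrsim na_n$ and $s_f\gtrsim\log(n)\,na_n$ (with constants depending on $\gamma,d,d_Y$). Let $(\hat g^c_n)_{n\in\mathbb N}$ be a sequence of random variables (random functions $\mathbb R^{d_Z+d_Y}\to\mathbb R^d$) with $\mathbb E W^c_{1,n}(\hat g_n^c) \to 0$. Then $$\hat g^c_n(Z,Y) \overset{d}{\to} g^{*}(Z,Y) = X.$$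
   Context: Notation: $a\gtrsim b$ means $a\ge cb$ for a suitable constant $c>0$; $\overset{d}{\to}$ is convergence in distribution; $\mathbb P^{V}$ is the distribution of a random variable $V$. $(X,Y)$ is a random vector with values in $[0,1]^d\times[0,1]^{d_Y}$, and $Z$ a random variable with values in $[0,1]^{d_Z}$ and known distribution, independent of $Y$. Hölder classes: for $T\subset\mathbb R^r$, $\beta\ge1$, $K>0$, $C^\beta(T,K)$ is the set of $f:T\to\mathbb R$ with $\sum_{0\le|\alpha|<\beta}\|\partial^\alpha f\|_\infty+\sum_{|\alpha|=\beta-1}\sup_{x\ne y}\frac{|\partial^\alpha f(x)-\partial^\alpha f(y)|}{|x-y|_\infty}\le K$ ($\alpha$ multi-indices). Encoder-decoder class: $\mathcal G^c(d_Z,d_Y,D,d_g,\beta,K)$ is the set of measurable $g:\mathbb R^{d_Z+d_Y}\to\mathbb R^d$ of the form $g=g_{dec}\circ g_{enc,1}\circ g_{enc,0}$, where each component of $g_{enc,0}:\mathbb R^{d_Z+d_Y}\to\mathbb R^D$ depends on only $d_g$ arguments and lies in $C^\beta([0,1]^{d_g},K)$; each component of $g_{enc,1}:\mathbb R^D\to\mathbb R^{d_g}$ lies in $C^{\tilde\beta}([0,1]^D,K)$ with some $\tilde\beta\ge\frac D{d_g}\beta$; each component of $g_{dec}:\mathbb R^{d_g}\to\mathbb R^d$ lies in $C^\beta([0,1]^{d_g},K)$. Networks: $\sigma(x)=\max\{x,0\}$, $\sigma_v(x)=\sigma(x-v)$ componentwise. For $L\in\mathbb N$, $\mathbf p=(p_0,\dots,p_{L+1})\in\mathbb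 N^{L+2}$, $s>0$, $F>0$, $\mathcal R(L,\mathbf p,s)=\mathcal R(L,\mathbf p,s,F)$ is the set of $h:\mathbb R^{p_0}\to\mathbb R^{p_{L+1}}$ of the form $h(x)=W^{(L)}\sigma_{v^{(L)}}W^{(L-1)}\cdots W^{(1)}\sigma_{v^{(1)}}W^{(0)}x$ with $W^{(l)}\in\mathbb R^{p_{l+1}\times p_l}$, $v^{(l)}\in\mathbb R^{p_l}$, all entries bounded by 1 in absolute value, at most $s$ nonzero entries in total, and $\sup_{x\in[0,1]^{p_0}}|h(x)|_\infty\le F$. The critic class is $\mathcal R(L_f,\mathbf p_f,s_f)$ with $p_{f,0}=d+d_Y$, $p_{f,L_f+1}=1$; its parameters may depend on $n$. $W^c_{1,n}(g)=\sup_{f\in\mathcal R(L_f,\mathbf p_f,s_f),\|f\|_L\le1}\{\mathbb Ef(X,Y)-\mathbb Ef(g(Z,Y),Y)\}$, with $\|f\|_L$ the Lipschitz constant with respect to the Euclidean norm; $W^c_{1,n}(\hat g_n^c)$ is this functional evaluated at the random function $\hat g_n^c$.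
   Formalization: Added: s_f − L_f → ∞ (if s_f ≤ L_f all critic networks are constant, W^c_{1,n} = 0 and the claim fails); the random functions ĝ_n are jointly measurable and independent of (Z,Y); g*(Z,Y) = X is equality in law. *)

theory Defs
  imports "HOL-Probability.Probability"
begin

definition unit_cube :: "(real ^ 'r) set" where
  "unit_cube = {x. \<forall>i. 0 \<le> x $ i \<and> x $ i \<le> 1}"

definition mi_order :: "('r::finite \<Rightarrow> nat) \<Rightarrow> nat" where
  "mi_order \<alpha> = (\<Sum>i\<in>UNIV. \<alpha> i)"

text \<open>
  The family \<open>Df\<close> consists of the partial derivatives \<open>Df \<alpha>\<close> of \<open>f\<close> on \<open>T\<close>, for all multi-indices
  \<open>\<alpha>\<close> of order less than \<open>\<beta>\<close>. Derivatives are taken within \<open>T\<close>, so they are one-sided on the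
  boundary of a cube, where they are uniquely determined. As \<open>Df\<close> is indexed by multi-indices, the
  derivatives do not depend on the order of differentiation.
\<close>

definition partial_derivs ::
  "real \<Rightarrow> (real ^ 'r) set \<Rightarrow> (real ^ 'r \<Rightarrow> real) \<Rightarrow> (('r \<Rightarrow> nat) \<Rightarrow> real ^ 'r \<Rightarrow> real) \<Rightarrow> bool" where
  "partial_derivs \<beta> T f Df \<longleftrightarrow>
     (\<forall>x\<in>T. Df (\<lambda>_. 0) x = f x) \<and>
     (\<forall>\<alpha> i. real (mi_order (\<alpha>(i := Suc (\<alpha> i)))) < \<beta> \<longrightarrow>
        (\<forall>x\<in>T. ((\<lambda>t. Df \<alpha> (x + t *\<^sub>R axis i 1)) has_real_derivative Df (\<alpha>(i := Suc (\<alpha> i))) x)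
                  (at 0 within {t. x + t *\<^sub>R axis i 1 \<in> T})))"

text \<open>
  The Hoelder class of functions on \<open>T\<close>; values outside \<open>T\<close> are irrelevant. The norms are computed in
  \<^typ>\<open>ennreal\<close>, so that an unbounded derivative or difference quotient has norm \<open>\<infinity>\<close>. The second sum
  is empty if \<open>\<beta>\<close> is not an integer.
\<close>

definition holder_class :: "real \<Rightarrow> (real ^ 'r) set \<Rightarrow> real \<Rightarrow> (real ^ 'r \<Rightarrow> real) set" where
  "holder_class \<beta> T K = {f. \<exists>Df. partial_derivs \<beta> T f Df \<and>
     (\<Sum>\<alpha> | real (mi_order \<alpha>) < \<beta>. SUP x\<in>T. ennreal \<bar>Df \<alpha> x\<bar>) +
     (\<Sum>\<alpha> | real (mi_order \<alpha>) = \<beta> - 1.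
        SUP (x, y)\<in>{(x, y). x \<in> T \<and> y \<in> T \<and> x \<noteq> y}.
          ennreal (\<bar>Df \<alpha> x - Df \<alpha> y\<bar> / infnorm (x - y)))
     \<le> ennreal K}"

text \<open>
  The coordinates of a point of $\mathbb{R}^{d_Z+d_Y}$, the latter being rendered as the product of
  $\mathbb{R}^{d_Z}$ and $\mathbb{R}^{d_Y}$ (with its Euclidean norm).
\<close>

definition pair_coord :: "(real ^ 'z) \<times> (real ^ 'y) \<Rightarrow> 'z + 'y \<Rightarrow> real" where
  "pair_coord u k = (case k of Inl i \<Rightarrow> fst u $ i | Inr j \<Rightarrow> snd u $ j)"

text \<open>
  The encoder-decoder class. The intermediate dimensions \<open>D\<close> and \<open>d\<^sub>g\<close> are the cardinalities of the
  types \<open>'D\<close> and \<open>'g\<close>. The injection \<open>\<pi>\<close> selects the \<open>d\<^sub>g\<close> arguments on which a component of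
  \<open>enc0\<close> depends.
\<close>

definition enc_dec_class ::
  "'D::finite itself \<Rightarrow> 'g::finite itself \<Rightarrow> real \<Rightarrow> real \<Rightarrow>
   ((real ^ 'z) \<times> (real ^ 'y) \<Rightarrow> real ^ 'd) set" where
  "enc_dec_class _ _ \<beta> K = {g. g \<in> borel_measurable borel \<and>
     (\<exists>(enc0 :: (real ^ 'z) \<times> (real ^ 'y) \<Rightarrow> real ^ 'D)
       (enc1 :: real ^ 'D \<Rightarrow> real ^ 'g)
       (dec :: real ^ 'g \<Rightarrow> real ^ 'd).
       g = dec \<circ> enc1 \<circ> enc0 \<and>
       (\<forall>k. \<exists>(\<pi> :: 'g \<Rightarrow> 'z + 'y) h. inj \<pi> \<and> h \<in> holder_class \<beta> unit_cube K \<and>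
          (\<forall>u. enc0 u $ k = h (\<chi> j. pair_coord u (\<pi> j)))) \<and>
       (\<forall>k. \<exists>\<beta>'. 1 \<le> \<beta>' \<and> real CARD('D) / real CARD('g) * \<beta> \<le> \<beta>' \<and>
          (\<lambda>x. enc1 x $ k) \<in> holder_class \<beta>' unit_cube K) \<and>
       (\<forall>k. (\<lambda>x. dec x $ k) \<in> holder_class \<beta> unit_cube K))}"

text \<open>
  Layer widths vary with the sample size, so vectors in $\mathbb{R}^{p}$ are functions \<open>nat \<Rightarrow> real\<close> of which only the
  entries with index less than \<open>p\<close> matter. \<open>W l i j\<close> is the entry in row \<open>i < p (l + 1)\<close> and column
  \<open>j < p l\<close> of the weight matrix of layer \<open>l \<le> L\<close>; \<open>v l i\<close>, for \<open>1 \<le> l \<le> L\<close> and \<open>i < p l\<close>, is an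
  entry of a shift vector. If \<open>s \<le> L\<close>, then at least one of the \<open>L + 1\<close> weight matrices of a network
  in \<open>relu_networks L p s F\<close> vanishes, so that all functions in the class are constant.
\<close>

definition relu :: "real \<Rightarrow> real" where
  "relu t = max t 0"

primrec net ::
  "(nat \<Rightarrow> nat \<Rightarrow> nat \<Rightarrow> real) \<Rightarrow> (nat \<Rightarrow> nat \<Rightarrow> real) \<Rightarrow> (nat \<Rightarrow> nat) \<Rightarrow> nat \<Rightarrow>
   (nat \<Rightarrow> real) \<Rightarrow> nat \<Rightarrow> real" where
  "net W v p 0 x = (\<lambda>i. \<Sum>j<p 0. W 0 i j * x j)"
| "net W v p (Suc l) x =
     (\<lambda>i. \<Sum>j<p (Suc l). W (Suc l) i j * relu (net W v p l x j - v (Suc l) j))"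

definition weight_idx :: "nat \<Rightarrow> (nat \<Rightarrow> nat) \<Rightarrow> (nat \<times> nat \<times> nat) set" where
  "weight_idx L p = {(l, i, j). l \<le> L \<and> i < p (l + 1) \<and> j < p l}"

definition shift_idx :: "nat \<Rightarrow> (nat \<Rightarrow> nat) \<Rightarrow> (nat \<times> nat) set" where
  "shift_idx L p = {(l, i). 1 \<le> l \<and> l \<le> L \<and> i < p l}"

definition relu_networks ::
  "nat \<Rightarrow> (nat \<Rightarrow> nat) \<Rightarrow> real \<Rightarrow> real \<Rightarrow> ((nat \<Rightarrow> real) \<Rightarrow> nat \<Rightarrow> real) set" where
  "relu_networks L p s F = {h. \<exists>W v. h = net W v p L \<and>
     (\<forall>(l, i, j)\<in>weight_idx L p. \<bar>W l i j\<bar> \<le> 1) \<and>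
     (\<forall>(l, i)\<in>shift_idx L p. \<bar>v l i\<bar> \<le> 1) \<and>
     real (card {(l, i, j)\<in>weight_idx L p. W l i j \<noteq> 0} +
           card {(l, i)\<in>shift_idx L p. v l i \<noteq> 0}) \<le> s \<and>
     (\<forall>x. (\<forall>j<p 0. 0 \<le> x j \<and> x j \<le> 1) \<longrightarrow> (\<forall>i<p (L + 1). \<bar>h x i\<bar> \<le> F))}"

text \<open>
  Scalar networks (\<open>p (L + 1) = 1\<close>) on a Euclidean space of dimension \<open>p 0\<close>. The enumeration of the
  coordinates is immaterial, since the columns of the first weight matrix can be permuted.
\<close>

definition critic_networks ::
  "nat \<Rightarrow> (nat \<Rightarrow> nat) \<Rightarrow> real \<Rightarrow> real \<Rightarrow> ('a::euclidean_space \<Rightarrow> real) set" where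
  "critic_networks L p s F =
     {\<lambda>x. h (\<lambda>j. x \<bullet> from_nat_into Basis j) 0 | h. h \<in> relu_networks L p s F}"

text \<open>
  The supremum is taken in \<^typ>\<open>ereal\<close>, as it may be infinite if \<open>g (Z, Y)\<close> is not integrable (then
  some of the expectations may not exist; the integral is \<open>0\<close> in that case). It is nonnegative for
  the critic networks, which include the zero function.
\<close>

definition critic_distance ::
  "'w measure \<Rightarrow> ('w \<Rightarrow> real ^ 'd) \<Rightarrow> ('w \<Rightarrow> real ^ 'y) \<Rightarrow> ('w \<Rightarrow> real ^ 'z) \<Rightarrow>
   ((real ^ 'd) \<times> (real ^ 'y) \<Rightarrow> real) set \<Rightarrow>
   ((real ^ 'z) \<times> (real ^ 'y) \<Rightarrow> real ^ 'd) \<Rightarrow> ereal" where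
  "critic_distance M X Y Z C g =
     (SUP f\<in>{f \<in> C. 1-lipschitz_on UNIV f}.
        ereal ((\<integral>\<omega>. f (X \<omega>, Y \<omega>) \<partial>M) - (\<integral>\<omega>. f (g (Z \<omega>, Y \<omega>), Y \<omega>) \<partial>M)))"

text \<open>
  Independence of random variables whose values may be of different types, which the library's
  \<open>indep_var\<close> does not allow.
\<close>

definition indep_rvs ::
  "'w measure \<Rightarrow> ('w \<Rightarrow> 'a::topological_space) \<Rightarrow> ('w \<Rightarrow> 'b::topological_space) \<Rightarrow> bool" where
  "indep_rvs M U V \<longleftrightarrow>
     prob_space.indep_set M (sets (vimage_algebra (space M) U borel))
       (sets (vimage_algebra (space M) V borel))"

text \<open>
  A random function \<open>G\<close> that is independent of the random variable \<open>V\<close>: \<open>G\<close> is jointly measurable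
  with respect to some \<sigma>-algebra \<open>A\<close> (e.g. the one generated by the training data) that is
  independent of \<open>V\<close>. Independence of \<open>V\<close> from the family of evaluations of \<open>G\<close> at fixed
  points would be too weak, as it does not determine the law of \<open>G \<omega> (V \<omega>)\<close>: consider the
  indicator function \<open>G \<omega>\<close> of \<open>{V \<omega>}\<close> for an atomless \<open>V\<close>.
\<close>

definition indep_random_function ::
  "'w measure \<Rightarrow> ('w \<Rightarrow> 'u::topological_space \<Rightarrow> 'b::topological_space) \<Rightarrow> ('w \<Rightarrow> 'u) \<Rightarrow> bool" where
  "indep_random_function M G V \<longleftrightarrow>
     (\<exists>A. subalgebra M A \<and>
          (\<lambda>(\<omega>, u). G \<omega> u) \<in> borel_measurable (A \<Otimes>\<^sub>M borel) \<and>
          prob_space.indep_set M (sets A) (sets (vimage_algebra (space M) V borel)))"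

definition conv_in_distribution ::
  "'w measure \<Rightarrow> (nat \<Rightarrow> 'w \<Rightarrow> 'b::metric_space) \<Rightarrow> ('w \<Rightarrow> 'b) \<Rightarrow> bool" where
  "conv_in_distribution M V V0 \<longleftrightarrow>
     (\<forall>\<phi> :: 'b \<Rightarrow> real. continuous_on UNIV \<phi> \<longrightarrow> bounded (range \<phi>) \<longrightarrow>
        (\<lambda>n. \<integral>\<omega>. \<phi> (V n \<omega>) \<partial>M) \<longlonglongrightarrow> (\<integral>\<omega>. \<phi> (V0 \<omega>) \<partial>M))"

definition rate :: "real \<Rightarrow> nat \<Rightarrow> nat \<Rightarrow> real" where
  "rate \<gamma> m n = real n powr (- (2 * \<gamma>) / (2 * \<gamma> + real m))"

end

theory Submission
  imports Defs
begin

text \<open>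
  For every direction \<open>w\<close> and thresholds \<open>a < b\<close>, a small multiple of the ramp
  \<open>relu (x \<bullet> w - a) - relu (x \<bullet> w - b)\<close> is computed by a network with two nodes in the first hidden
  layer. As widths, depths and the excess \<open>s\<^sub>f n - L\<^sub>f n\<close> of the sparsity over the depth tend to infinity,
  this ramp and its negative are critics for all large \<open>n\<close>, so their expectations converge. Ramps
  determine weak convergence on the real line, hence every one-dimensional projection of the generated
  variable converges in distribution. By a Cramer-Wold argument, in which tightness comes from the
  compact support of the limit and trigonometric polynomials are dense by Stone--Weierstrass, so does
  the generated variable itself. The independence of the generator from \<open>(Z, Y)\<close> enters to identify
  the expected critic gap with the gap for the generated variable.
\<close>

inductive_set trig_polys :: "('a::real_inner \<Rightarrow> real) set" where
  cos: "(\<lambda>x. c * cos (x \<bullet> w + b)) \<in> trig_polys"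
| add: "f \<in> trig_polys \<Longrightarrow> g \<in> trig_polys \<Longrightarrow> (\<lambda>x. f x + g x) \<in> trig_polys"

lemma trig_polys_continuous:
  assumes "f \<in> trig_polys" shows "continuous_on S f"
  using assms by induction (auto intro!: continuous_intros)

lemma trig_polys_bounded:
  assumes "f \<in> trig_polys" shows "\<exists>B. \<forall>x. \<bar>f x\<bar> \<le> B"
  using assms
proof induction
  case (cos c w b)
  have "\<bar>c * cos (x \<bullet> w + b)\<bar> \<le> \<bar>c\<bar>" for x
    by (simp add: abs_mult mult_left_le)
  then show ?case by blast
next
  case (add f g)
  then obtain B C where "\<forall>x. \<bar>f x\<bar> \<le> B" "\<forall>x. \<bar>g x\<bar> \<le> C" by blast
  then have "\<bar>f x + g x\<bar> \<le> B + C" for x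
    by (meson abs_triangle_ineq add_mono order_trans)
  then show ?case by blast
qed

lemma trig_polys_cos_times_cos:
  "(\<lambda>x. c * cos (x \<bullet> w + b) * (c' * cos (x \<bullet> w' + b'))) \<in> trig_polys"
proof -
  have "(\<lambda>x. c * cos (x \<bullet> w + b) * (c' * cos (x \<bullet> w' + b'))) =
        (\<lambda>x. c * c' / 2 * cos (x \<bullet> (w - w') + (b - b')) + c * c' / 2 * cos (x \<bullet> (w + w') + (b + b')))"
  proof
    fix x
    have *: "x \<bullet> (w - w') + (b - b') = (x \<bullet> w + b) - (x \<bullet> w' + b')"
      "x \<bullet> (w + w') + (b + b') = (x \<bullet> w + b) + (x \<bullet> w' + b')"
      by (simp_all add: inner_diff_right inner_add_right)
    show "c * cos (x \<bullet> w + b) * (c' * cos (x \<bullet> w' + b')) =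
        c * c' / 2 * cos (x \<bullet> (w - w') + (b - b')) + c * c' / 2 * cos (x \<bullet> (w + w') + (b + b'))"
      unfolding * cos_diff cos_add by (simp add: field_simps)
  qed
  then show ?thesis by (simp only: trig_polys.intros)
qed

lemma trig_polys_mult:
  assumes "f \<in> trig_polys" "g \<in> trig_polys" shows "(\<lambda>x. f x * g x) \<in> trig_polys"
  using assms(1)
proof induction
  case (cos c w b)
  show ?case
    using assms(2)
  proof induction
    case (cos c' w' b')
    show ?case by (rule trig_polys_cos_times_cos)
  next
    case (add f g)
    then show ?case using trig_polys.add by (fastforce simp: distrib_left)
  qed
next
  case (add f h)
  then show ?case using trig_polys.add by (fastforce simp: distrib_right)
qed

lemma function_ring_on_trig_polys:
  fixes S :: "'a::euclidean_space set"
  assumes "compact S"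
  shows "function_ring_on trig_polys S"
proof
  show "(\<lambda>_. c) \<in> (trig_polys :: ('a \<Rightarrow> real) set)" for c
    using trig_polys.cos[of c 0 0] by simp
  fix x y :: 'a assume "x \<noteq> y"
  define w where "w = (1 / (norm (x - y))\<^sup>2) *\<^sub>R (x - y)"
  have "x \<bullet> w - y \<bullet> w = 1"
    unfolding inner_diff_left[symmetric] using \<open>x \<noteq> y\<close> by (simp add: w_def power2_norm_eq_inner)
  then have *: "x \<bullet> w + (- (y \<bullet> w)) = 1" by simp
  have "cos (1::real) \<noteq> 1"
    using cos_monotone_0_pi[of 0 1] pi_gt3 by simp
  then have "1 * cos (x \<bullet> w + (- (y \<bullet> w))) \<noteq> 1 * cos (y \<bullet> w + (- (y \<bullet> w)))"
    unfolding * by simp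
  then show "\<exists>f\<in>trig_polys. f x \<noteq> f y"
    using trig_polys.cos[of 1 w "- (y \<bullet> w)"] by (intro bexI)
qed (use assms in \<open>auto intro: trig_polys_continuous trig_polys.add trig_polys_mult\<close>)

lemma (in prob_space) conv_in_distribution_Cramer_Wold:
  fixes V :: "nat \<Rightarrow> 'a \<Rightarrow> 'b::euclidean_space"
  assumes V[measurable]: "\<And>n. V n \<in> borel_measurable M"
    and V0[measurable]: "V0 \<in> borel_measurable M"
    and bounded: "bounded (V0 ` space M)"
    and conv: "\<And>w. weak_conv_m (\<lambda>n. distr M borel (\<lambda>\<omega>. V n \<omega> \<bullet> w)) (distr M borel (\<lambda>\<omega>. V0 \<omega> \<bullet> w))"
  shows "conv_in_distribution M V V0"
proof -
  have ridge: "(\<lambda>n. \<integral>\<omega>. \<psi> (V n \<omega> \<bullet> w) \<partial>M) \<longlonglongrightarrow> (\<integral>\<omega>. \<psi> (V0 \<omega> \<bullet> w) \<partial>M)"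
    if "continuous_on UNIV \<psi>" and "\<And>t. \<bar>\<psi> t\<bar> \<le> C" for \<psi> :: "real \<Rightarrow> real" and w C
  proof -
    have [measurable]: "\<psi> \<in> borel_measurable borel"
      using that(1) by (rule borel_measurable_continuous_onI)
    have "(\<lambda>n. integral\<^sup>L (distr M borel (\<lambda>\<omega>. V n \<omega> \<bullet> w)) \<psi>)
      \<longlonglongrightarrow> integral\<^sup>L (distr M borel (\<lambda>\<omega>. V0 \<omega> \<bullet> w)) \<psi>"
      using that by (intro weak_conv_imp_integral_bdd_continuous_conv[OF _ _ conv, where B = C])
        (auto simp: continuous_on_eq_continuous_at)
    then show ?thesis by (simp add: integral_distr)
  qed
  have trig_measurable: "f \<in> borel_measurable borel" if "f \<in> trig_polys" for f :: "'b \<Rightarrow> real"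
    using that by (intro borel_measurable_continuous_onI trig_polys_continuous)
  have trig: "(\<lambda>n. \<integral>\<omega>. g (V n \<omega>) \<partial>M) \<longlonglongrightarrow> (\<integral>\<omega>. g (V0 \<omega>) \<partial>M)" if "g \<in> trig_polys" for g
    using that
  proof induction
    case (cos c w b)
    have "\<bar>c * cos (t + b)\<bar> \<le> \<bar>c\<bar>" for t
      by (simp add: abs_mult mult_left_le)
    then show ?case
      by (intro ridge[of "\<lambda>t. c * cos (t + b)" "\<bar>c\<bar>"]) (auto intro!: continuous_intros)
  next
    case (add f g)
    have "integrable M (\<lambda>\<omega>. h (W \<omega>))" if h: "h \<in> trig_polys" and W: "W \<in> borel_measurable M" for h :: "'b \<Rightarrow> real" and W
    proof -
      obtain B where "\<forall>x. \<bar>h x\<bar> \<le> B" using trig_polys_bounded[OF h] ..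
      then show ?thesis
        using measurable_compose[OF W trig_measurable[OF h]]
        by (intro integrable_const_bound[of _ B]) auto
    qed
    then show ?case
      using add by (auto intro!: tendsto_add)
  qed
  obtain B where B: "\<And>\<omega>. \<omega> \<in> space M \<Longrightarrow> norm (V0 \<omega>) \<le> B"
    using bounded by (auto simp: bounded_iff)
  define S where "S = cbox (- (B + 1) *\<^sub>R One) ((B + 1) *\<^sub>R (One :: 'b))"
  have S_iff: "x \<in> S \<longleftrightarrow> (\<forall>i\<in>Basis. \<bar>x \<bullet> i\<bar> \<le> B + 1)" for x
    by (auto simp: S_def mem_box abs_le_iff)
  define \<psi> where "\<psi> t = min 1 (max 0 (\<bar>t\<bar> - B))" for t
  define \<tau> where "\<tau> n = (\<Sum>i\<in>Basis. \<integral>\<omega>. \<psi> (V n \<omega> \<bullet> i) \<partial>M)" for n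
  have \<psi>: "0 \<le> \<psi> t" "\<psi> t \<le> 1" for t by (auto simp: \<psi>_def)
  have \<psi>_cont: "continuous_on UNIV \<psi>"
    unfolding \<psi>_def by (intro continuous_intros)
  then have [measurable]: "\<psi> \<in> borel_measurable borel"
    by (rule borel_measurable_continuous_onI)
  have \<psi>_int: "integrable M (\<lambda>\<omega>. \<psi> (V n \<omega> \<bullet> i))" for n i
    by (intro integrable_const_bound[of _ 1]) (auto simp: \<psi>)
  have \<tau>: "\<tau> \<longlonglongrightarrow> 0"
    unfolding \<tau>_def
  proof (rule tendsto_null_sum)
    fix i :: 'b assume i: "i \<in> Basis"
    have "\<psi> (V0 \<omega> \<bullet> i) = 0" if "\<omega> \<in> space M" for \<omega>
      using Basis_le_norm[OF i, of "V0 \<omega>"] B[OF that] by (auto simp: \<psi>_def)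
    then have "(\<integral>\<omega>. \<psi> (V0 \<omega> \<bullet> i) \<partial>M) = 0" by (simp cong: Bochner_Integration.integral_cong)
    then show "(\<lambda>n. \<integral>\<omega>. \<psi> (V n \<omega> \<bullet> i) \<partial>M) \<longlonglongrightarrow> 0"
      using ridge[OF \<psi>_cont, of 1 i] \<psi> by simp
  qed
  have outside: "1 \<le> (\<Sum>i\<in>Basis. \<psi> (x \<bullet> i))" if x: "x \<notin> S" for x
  proof -
    obtain i where i: "i \<in> Basis" "\<bar>x \<bullet> i\<bar> > B + 1"
      using x by (auto simp: S_iff not_le)
    then have "1 = \<psi> (x \<bullet> i)" by (simp add: \<psi>_def)
    also have "\<dots> \<le> (\<Sum>i\<in>Basis. \<psi> (x \<bullet> i))"
      using i \<psi> by (intro member_le_sum) auto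
    finally show ?thesis .
  qed
  show ?thesis
    unfolding conv_in_distribution_def
  proof (intro allI impI)
    fix \<phi> :: "'b \<Rightarrow> real" assume \<phi>: "continuous_on UNIV \<phi>" "bounded (range \<phi>)"
    have [measurable]: "\<phi> \<in> borel_measurable borel"
      using \<phi>(1) by (rule borel_measurable_continuous_onI)
    obtain C where C: "\<And>x. \<bar>\<phi> x\<bar> \<le> C"
      using \<phi>(2) by (auto simp: bounded_iff)
    have \<phi>_int: "integrable M (\<lambda>\<omega>. \<phi> (W \<omega>))" if "W \<in> borel_measurable M" for W
      using that C by (intro integrable_const_bound[of _ C]) auto
    show "(\<lambda>n. \<integral>\<omega>. \<phi> (V n \<omega>) \<partial>M) \<longlonglongrightarrow> (\<integral>\<omega>. \<phi> (V0 \<omega>) \<partial>M)"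
    proof (rule tendstoI)
      fix e :: real assume e: "0 < e"
      interpret function_ring_on trig_polys S
        by (rule function_ring_on_trig_polys) (simp add: S_def)
      obtain g where g: "g \<in> trig_polys" and g_near: "\<And>x. x \<in> S \<Longrightarrow> \<bar>\<phi> x - g x\<bar> < e / 4"
        using Stone_Weierstrass_basic[of \<phi> "e / 4"] e continuous_on_subset[OF \<phi>(1)] by auto
      obtain C' where C': "\<And>x. \<bar>g x\<bar> \<le> C'"
        using trig_polys_bounded[OF g] by blast
      note [measurable] = trig_measurable[OF g]
      have g_int: "integrable M (\<lambda>\<omega>. g (W \<omega>))" if "W \<in> borel_measurable M" for W
        using that C' by (intro integrable_const_bound[of _ C']) auto
      have near: "\<bar>\<phi> x - g x\<bar> \<le> e / 4 + (C + C') * (\<Sum>i\<in>Basis. \<psi> (x \<bullet> i))" for x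
      proof (cases "x \<in> S")
        case True
        have "0 \<le> C + C'" using C[of 0] C'[of 0] by linarith
        then have "0 \<le> (C + C') * (\<Sum>i\<in>Basis. \<psi> (x \<bullet> i))"
          using \<psi> by (intro mult_nonneg_nonneg sum_nonneg) auto
        then show ?thesis using g_near[OF True] by linarith
      next
        case False
        have "\<bar>\<phi> x - g x\<bar> \<le> C + C'" using C[of x] C'[of x] by linarith
        also have "\<dots> \<le> (C + C') * (\<Sum>i\<in>Basis. \<psi> (x \<bullet> i))"
          using mult_left_mono[OF outside[OF False], of "C + C'"] C[of 0] C'[of 0] by simp
        finally show ?thesis using e by linarith
      qed
      have diff_n: "\<bar>(\<integral>\<omega>. \<phi> (V n \<omega>) \<partial>M) - (\<integral>\<omega>. g (V n \<omega>) \<partial>M)\<bar> \<le> e / 4 + (C + C') * \<tau> n" for n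
      proof -
        have "\<bar>(\<integral>\<omega>. \<phi> (V n \<omega>) \<partial>M) - (\<integral>\<omega>. g (V n \<omega>) \<partial>M)\<bar> = \<bar>\<integral>\<omega>. \<phi> (V n \<omega>) - g (V n \<omega>) \<partial>M\<bar>"
          using \<phi>_int[OF V] g_int[OF V] by simp
        also have "\<dots> \<le> (\<integral>\<omega>. \<bar>\<phi> (V n \<omega>) - g (V n \<omega>)\<bar> \<partial>M)"
          by (rule integral_abs_bound)
        also have "\<dots> \<le> (\<integral>\<omega>. e / 4 + (C + C') * (\<Sum>i\<in>Basis. \<psi> (V n \<omega> \<bullet> i)) \<partial>M)"
          using \<phi>_int[OF V] g_int[OF V] \<psi>_int near by (intro integral_mono) auto
        also have "\<dots> = e / 4 + (C + C') * \<tau> n"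
          using \<psi>_int by (simp add: \<tau>_def prob_space)
        finally show ?thesis .
      qed
      have diff_0: "\<bar>(\<integral>\<omega>. \<phi> (V0 \<omega>) \<partial>M) - (\<integral>\<omega>. g (V0 \<omega>) \<partial>M)\<bar> \<le> e / 4"
      proof -
        have in_S: "V0 \<omega> \<in> S" if "\<omega> \<in> space M" for \<omega>
          unfolding S_iff
        proof
          fix i :: 'b assume "i \<in> Basis"
          then show "\<bar>V0 \<omega> \<bullet> i\<bar> \<le> B + 1"
            using Basis_le_norm[of i "V0 \<omega>"] B[OF that] by linarith
        qed
        have "\<bar>(\<integral>\<omega>. \<phi> (V0 \<omega>) \<partial>M) - (\<integral>\<omega>. g (V0 \<omega>) \<partial>M)\<bar> = \<bar>\<integral>\<omega>. \<phi> (V0 \<omega>) - g (V0 \<omega>) \<partial>M\<bar>"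
          using \<phi>_int[OF V0] g_int[OF V0] by simp
        also have "\<dots> \<le> (\<integral>\<omega>. \<bar>\<phi> (V0 \<omega>) - g (V0 \<omega>)\<bar> \<partial>M)"
          by (rule integral_abs_bound)
        also have "\<dots> \<le> (\<integral>\<omega>. e / 4 \<partial>M)"
          using \<phi>_int[OF V0] g_int[OF V0] in_S g_near
          by (intro integral_mono) (auto intro: less_imp_le)
        finally show ?thesis by (simp add: prob_space)
      qed
      have "(\<lambda>n. (C + C') * \<tau> n) \<longlonglongrightarrow> (C + C') * 0"
        by (intro tendsto_intros \<tau>)
      then have "\<forall>\<^sub>F n in sequentially. (C + C') * \<tau> n < e / 4"
        using e by (intro order_tendstoD(2)[where y = 0]) auto
      moreover have "\<forall>\<^sub>F n in sequentially.
          dist (\<integral>\<omega>. g (V n \<omega>) \<partial>M) (\<integral>\<omega>. g (V0 \<omega>) \<partial>M) < e / 4"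
        using e by (intro tendstoD[OF trig[OF g]]) auto
      ultimately show "\<forall>\<^sub>F n in sequentially.
          dist (\<integral>\<omega>. \<phi> (V n \<omega>) \<partial>M) (\<integral>\<omega>. \<phi> (V0 \<omega>) \<partial>M) < e"
      proof eventually_elim
        case (elim n)
        then show ?case
          using diff_n[of n] diff_0 unfolding dist_real_def by linarith
      qed
    qed
  qed
qed

lemma relu_ramp:
  assumes "a < b"
  shows "relu (t - a) - relu (t - b) = (b - a) * (1 - cts_step a b t)"
  using assms by (auto simp: relu_def cts_step_def field_simps)

lemma relu_ramp_bounds:
  assumes "a \<le> b"
  shows "0 \<le> relu (t - a) - relu (t - b)" "relu (t - a) - relu (t - b) \<le> b - a"
  using assms by (auto simp: relu_def)

text \<open>
  The two nodes of the first hidden layer form a ramp; being nonnegative, it passes unchanged through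
  the remaining layers at the cost of one nonzero weight per layer.
\<close>

lemma relu_networks_ramp:
  assumes L: "2 \<le> L" and p1: "2 \<le> p 1" and p: "\<And>i. i \<in> {1..L} \<Longrightarrow> 1 \<le> p i" and pL: "p (L + 1) = 1"
    and u: "\<And>j. j < p 0 \<Longrightarrow> \<bar>u j\<bar> \<le> 1" and a: "\<bar>a\<bar> \<le> 1" and b: "\<bar>b\<bar> \<le> 1"
    and ab: "a \<le> b" "b - a \<le> F" and \<sigma>: "\<bar>\<sigma>\<bar> \<le> 1" and s: "real (L + 2 * p 0 + 3) \<le> s"
  shows "\<exists>h\<in>relu_networks L p s F. \<forall>x. h x 0 =
    \<sigma> * (relu ((\<Sum>j<p 0. u j * x j) - a) - relu ((\<Sum>j<p 0. u j * x j) - b))"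
proof -
  define W :: "nat \<Rightarrow> nat \<Rightarrow> nat \<Rightarrow> real" where "W l i j =
    (if l = 0 then if i < 2 then u j else 0
     else if i \<noteq> 0 then 0
     else if l = 1 then if j = 0 then 1 else if j = 1 then - 1 else 0
     else if j \<noteq> 0 then 0 else if l = L then \<sigma> else 1)" for l i j
  define v :: "nat \<Rightarrow> nat \<Rightarrow> real" where "v l i =
    (if l = 1 then if i = 0 then a else if i = 1 then b else 0 else 0)" for l i
  define R where "R x = relu ((\<Sum>j<p 0. u j * x j) - a) - relu ((\<Sum>j<p 0. u j * x j) - b)"
    for x :: "nat \<Rightarrow> real"
  have R: "0 \<le> R x" "R x \<le> F" for x
    using relu_ramp_bounds[of a b] ab by (auto simp: R_def intro: order_trans)
  have layer1: "net W v p 1 x 0 = R x" for x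
  proof -
    have "net W v p 1 x 0 =
        (\<Sum>j\<in>{..<p 1}. W 1 0 j * relu (net W v p 0 x j - v 1 j))"
      by simp
    also have "\<dots> = (\<Sum>j\<in>{0, 1}. W 1 0 j * relu (net W v p 0 x j - v 1 j))"
      using p1 by (intro sum.mono_neutral_right) (auto simp: W_def)
    finally show ?thesis by (simp add: W_def v_def R_def)
  qed
  have next_layer: "net W v p (Suc l) x 0 = (if Suc l = L then \<sigma> else 1) * relu (net W v p l x 0)"
    if "1 \<le> l" "Suc l \<le> L" for l x
  proof -
    have "net W v p (Suc l) x 0 =
        (\<Sum>j\<in>{..<p (Suc l)}. W (Suc l) 0 j * relu (net W v p l x j - v (Suc l) j))"
      by simp
    also have "\<dots> = (\<Sum>j\<in>{0}. W (Suc l) 0 j * relu (net W v p l x j - v (Suc l) j))"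
      using that p[of "Suc l"] by (intro sum.mono_neutral_right) (auto simp: W_def)
    finally show ?thesis using that by (simp add: W_def v_def)
  qed
  have carry: "net W v p l x 0 = R x" if "1 \<le> l" "l < L" for l x
    using that
  proof (induction l rule: dec_induct)
    case (step l)
    then show ?case using next_layer[of l x] R[of x]
      by (simp add: relu_def)
  qed (use layer1 in simp)
  have out: "net W v p L x 0 = \<sigma> * R x" for x
    using next_layer[of "L - 1" x] carry[of "L - 1" x] L R[of x] by (simp add: relu_def)
  let ?A = "{(l, i, j)\<in>weight_idx L p. W l i j \<noteq> 0}"
  let ?A' = "{0} \<times> {..<2::nat} \<times> {..<p 0} \<union> insert (1, 0, 1) ({1..L} \<times> {0} \<times> {0})"
  let ?B = "{(l, i)\<in>shift_idx L p. v l i \<noteq> 0}"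
  have "(l, i, j) \<in> ?A'" if "(l, i, j) \<in> weight_idx L p" "W l i j \<noteq> 0" for l i j
    using that by (cases "l = 0"; cases "l = 1") (simp_all add: weight_idx_def W_def split: if_splits)
  then have "?A \<subseteq> ?A'"
    by blast
  then have "card ?A \<le> card ?A'"
    by (intro card_mono) auto
  also have "\<dots> \<le> 2 * p 0 + (1 + L)"
    by (rule order_trans[OF card_Un_le]) (simp add: card_cartesian_product card_insert_if)
  finally have cA: "card ?A \<le> 2 * p 0 + (1 + L)" .
  have "card ?B \<le> card {(1::nat, 0::nat), (1, 1)}"
    by (intro card_mono) (auto simp: v_def split: if_splits)
  then have cB: "card ?B \<le> 2" by simp
  have "net W v p L \<in> relu_networks L p s F"
    unfolding relu_networks_def mem_Collect_eq
  proof (intro exI[of _ W] exI[of _ v] conjI refl)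
    show "\<forall>(l, i, j)\<in>weight_idx L p. \<bar>W l i j\<bar> \<le> 1"
      using u \<sigma> by (auto simp: W_def weight_idx_def)
    show "\<forall>(l, i)\<in>shift_idx L p. \<bar>v l i\<bar> \<le> 1"
      using a b by (auto simp: v_def)
    have "card ?A + card ?B \<le> L + 2 * p 0 + 3"
      using cA cB by linarith
    then show "real (card ?A + card ?B) \<le> s"
      using s by (meson of_nat_le_iff order_trans)
    have "\<bar>\<sigma> * R x\<bar> \<le> F" for x
    proof -
      have "\<bar>\<sigma> * R x\<bar> \<le> 1 * R x"
        unfolding abs_mult using \<sigma> R[of x] by (intro mult_mono) auto
      then show ?thesis using R(2)[of x] by linarith
    qed
    then show "\<forall>x. (\<forall>j<p 0. 0 \<le> x j \<and> x j \<le> 1) \<longrightarrow> (\<forall>i<p (L + 1). \<bar>net W v p L x i\<bar> \<le> F)"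
      using pL out by simp
  qed
  then show ?thesis
    using out by (intro bexI[of _ "net W v p L"]) (auto simp: R_def)
qed

lemma critic_networks_ramp:
  fixes w :: "'a::euclidean_space"
  assumes "2 \<le> L" "2 \<le> p 1" "\<And>i. i \<in> {1..L} \<Longrightarrow> 1 \<le> p i" "p (L + 1) = 1" "p 0 = DIM('a)"
    and w: "norm w \<le> 1" and "\<bar>a\<bar> \<le> 1" "\<bar>b\<bar> \<le> 1" "a \<le> b" "b - a \<le> F" "\<bar>\<sigma>\<bar> \<le> 1"
    and "real (L + 2 * p 0 + 3) \<le> s"
  shows "(\<lambda>x. \<sigma> * (relu (x \<bullet> w - a) - relu (x \<bullet> w - b))) \<in> critic_networks L p s F"
proof -
  let ?e = "from_nat_into (Basis :: 'a set)"
  have bij: "bij_betw ?e {..<p 0} Basis"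
    using bij_betw_from_nat_into_finite[of "Basis :: 'a set"] assms(5) by simp
  have "\<bar>w \<bullet> ?e j\<bar> \<le> 1" if "j < p 0" for j
    using Basis_le_norm[of "?e j" w] bij_betwE[OF bij] that w by fastforce
  then obtain h where h: "h \<in> relu_networks L p s F" and h_eq: "\<And>x. h x 0 = \<sigma> *
      (relu ((\<Sum>j<p 0. (w \<bullet> ?e j) * x j) - a) - relu ((\<Sum>j<p 0. (w \<bullet> ?e j) * x j) - b))"
    using relu_networks_ramp[of L p "\<lambda>j. w \<bullet> ?e j" a b F \<sigma> s] assms by blast
  have "(\<Sum>j<p 0. (w \<bullet> ?e j) * (x \<bullet> ?e j)) = x \<bullet> w" for x
  proof -
    have "(\<Sum>j<p 0. (w \<bullet> ?e j) * (x \<bullet> ?e j)) = (\<Sum>i\<in>Basis. (w \<bullet> i) * (x \<bullet> i))"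
      by (rule sum.reindex_bij_betw[OF bij])
    then show ?thesis by (simp add: euclidean_inner[of x w] mult.commute)
  qed
  then have "(\<lambda>x. \<sigma> * (relu (x \<bullet> w - a) - relu (x \<bullet> w - b))) = (\<lambda>x. h (\<lambda>j. x \<bullet> ?e j) 0)"
    by (simp add: h_eq)
  then show ?thesis
    unfolding critic_networks_def using h by blast
qed

lemma lipschitz_on_ramp:
  fixes w :: "'a::euclidean_space"
  assumes "norm w \<le> 1" "\<bar>\<sigma>\<bar> \<le> 1" "a \<le> b"
  shows "1-lipschitz_on UNIV (\<lambda>x. \<sigma> * (relu (x \<bullet> w - a) - relu (x \<bullet> w - b)))"
proof (rule lipschitz_onI)
  fix x y :: 'a
  have "\<bar>(relu (s - a) - relu (s - b)) - (relu (t - a) - relu (t - b))\<bar> \<le> \<bar>s - t\<bar>" for s t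
    using assms(3) by (auto simp: relu_def)
  then have "\<bar>\<sigma>\<bar> * \<bar>(relu (x \<bullet> w - a) - relu (x \<bullet> w - b)) - (relu (y \<bullet> w - a) - relu (y \<bullet> w - b))\<bar>
      \<le> 1 * \<bar>x \<bullet> w - y \<bullet> w\<bar>"
    using assms(2) by (intro mult_mono) auto
  also have "\<dots> \<le> norm (x - y) * norm w"
    by (simp add: inner_diff_left[symmetric] Cauchy_Schwarz_ineq2)
  also have "\<dots> \<le> 1 * norm (x - y)"
    using assms(1) by (simp add: mult_left_le)
  finally show "dist (\<sigma> * (relu (x \<bullet> w - a) - relu (x \<bullet> w - b)))
      (\<sigma> * (relu (y \<bullet> w - a) - relu (y \<bullet> w - b))) \<le> 1 * dist x y"
    by (simp add: dist_real_def dist_norm abs_mult[symmetric] right_diff_distrib)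
qed simp

lemma (in prob_space) distr_pair_indep_set:
  assumes A: "subalgebra M A" and V[measurable]: "V \<in> borel_measurable M"
    and indep: "indep_set (sets A) (sets (vimage_algebra (space M) V borel))"
  shows "distr M (A \<Otimes>\<^sub>M borel) (\<lambda>\<omega>. (\<omega>, V \<omega>)) = distr M A (\<lambda>\<omega>. \<omega>) \<Otimes>\<^sub>M distr M borel V"
proof -
  have id[measurable]: "(\<lambda>\<omega>. \<omega>) \<in> M \<rightarrow>\<^sub>M A"
    using A by (auto simp: subalgebra_def measurable_def sets.Int_space_eq2)
  interpret A: prob_space "distr M A (\<lambda>\<omega>. \<omega>)" by (rule prob_space_distr) (rule id)
  interpret D: prob_space "distr M borel V" by (rule prob_space_distr) (rule V)
  show ?thesis
  proof (rule pair_measure_eqI[symmetric])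
    fix S T assume S: "S \<in> sets (distr M A (\<lambda>\<omega>. \<omega>))" and T: "T \<in> sets (distr M borel V)"
    then have [measurable]: "S \<in> sets A" "T \<in> sets borel" by auto
    have "S \<subseteq> space M" using S A sets.sets_into_space[of S A] by (auto simp: subalgebra_def)
    have "S \<in> events" using S A by (auto simp: subalgebra_def)
    have "V -` T \<inter> space M \<in> sets (vimage_algebra (space M) V borel)"
      using T by (intro in_vimage_algebra) auto
    then have "prob (S \<inter> (V -` T \<inter> space M)) = prob S * prob (V -` T \<inter> space M)"
      using indep_setD[OF indep] S by auto
    moreover have "(\<lambda>\<omega>. (\<omega>, V \<omega>)) -` (S \<times> T) \<inter> space M = S \<inter> (V -` T \<inter> space M)"
      by auto
    moreover have "(\<lambda>\<omega>. \<omega>) -` S \<inter> space M = S" using \<open>S \<subseteq> space M\<close> by auto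
    ultimately show "emeasure (distr M A (\<lambda>\<omega>. \<omega>)) S * emeasure (distr M borel V) T =
        emeasure (distr M (A \<Otimes>\<^sub>M borel) (\<lambda>\<omega>. (\<omega>, V \<omega>))) (S \<times> T)"
      by (simp add: emeasure_distr emeasure_eq_measure ennreal_mult[symmetric])
  qed (simp_all add: A.sigma_finite_measure_axioms D.sigma_finite_measure_axioms)
qed

lemma indep_random_function_measurable:
  assumes "indep_random_function M G V" and V[measurable]: "V \<in> borel_measurable M"
  shows "(\<lambda>\<omega>. G \<omega> (V \<omega>)) \<in> borel_measurable M"
    and "\<And>\<omega>. \<omega> \<in> space M \<Longrightarrow> G \<omega> \<in> borel_measurable borel"
proof -
  obtain A where A: "subalgebra M A" and G[measurable]: "(\<lambda>(\<omega>, u). G \<omega> u) \<in> borel_measurable (A \<Otimes>\<^sub>M borel)"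
    using assms(1) by (auto simp: indep_random_function_def)
  have id[measurable]: "(\<lambda>\<omega>. \<omega>) \<in> M \<rightarrow>\<^sub>M A"
    using A by (auto simp: subalgebra_def measurable_def sets.Int_space_eq2)
  have "(\<lambda>\<omega>. (\<lambda>(\<omega>, u). G \<omega> u) (\<omega>, V \<omega>)) \<in> borel_measurable M"
    by measurable
  then show "(\<lambda>\<omega>. G \<omega> (V \<omega>)) \<in> borel_measurable M" by simp
  fix \<omega> assume "\<omega> \<in> space M"
  then have "\<omega> \<in> space A" using A by (simp add: subalgebra_def)
  then have "(\<lambda>u. (\<lambda>(\<omega>, u). G \<omega> u) (\<omega>, u)) \<in> borel_measurable borel" by measurable
  then show "G \<omega> \<in> borel_measurable borel" by simp
qed

lemma (in prob_space) integral_indep_random_function: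
  fixes \<psi> :: "'b::topological_space \<Rightarrow> real"
  assumes G: "indep_random_function M G V" and V[measurable]: "V \<in> borel_measurable M"
    and \<psi>[measurable]: "\<psi> \<in> borel_measurable borel" and bound: "\<And>x. \<bar>\<psi> x\<bar> \<le> B"
  shows "(\<lambda>\<omega>. \<integral>\<omega>'. \<psi> (G \<omega> (V \<omega>')) \<partial>M) \<in> borel_measurable M"
    and "(\<integral>\<omega>. (\<integral>\<omega>'. \<psi> (G \<omega> (V \<omega>')) \<partial>M) \<partial>M) = (\<integral>\<omega>. \<psi> (G \<omega> (V \<omega>)) \<partial>M)"
proof -
  obtain A where A: "subalgebra M A"
    and G'[measurable]: "(\<lambda>(\<omega>, u). G \<omega> u) \<in> borel_measurable (A \<Otimes>\<^sub>M borel)"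
    and indep: "indep_set (sets A) (sets (vimage_algebra (space M) V borel))"
    using G by (auto simp: indep_random_function_def)
  have id[measurable]: "(\<lambda>\<omega>. \<omega>) \<in> M \<rightarrow>\<^sub>M A"
    using A by (auto simp: subalgebra_def measurable_def sets.Int_space_eq2)
  interpret A: prob_space "distr M A (\<lambda>\<omega>. \<omega>)" by (rule prob_space_distr) (rule id)
  interpret D: prob_space "distr M borel V" by (rule prob_space_distr) (rule V)
  interpret P: pair_prob_space "distr M A (\<lambda>\<omega>. \<omega>)" "distr M borel V" ..
  have m[measurable]: "(\<lambda>(\<omega>, u). \<psi> (G \<omega> u)) \<in> borel_measurable (A \<Otimes>\<^sub>M borel)"
    using measurable_compose[OF G' \<psi>] by (simp add: case_prod_beta')
  have m_section: "(\<lambda>u. \<psi> (G \<omega> u)) \<in> borel_measurable borel" if "\<omega> \<in> space M" for \<omega>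
    using measurable_compose[OF indep_random_function_measurable(2)[OF G V that] \<psi>] .
  have inner: "(\<integral>u. \<psi> (G \<omega> u) \<partial>distr M borel V) = (\<integral>\<omega>'. \<psi> (G \<omega> (V \<omega>')) \<partial>M)"
    if "\<omega> \<in> space M" for \<omega>
    by (rule integral_distr[OF V m_section[OF that]])
  have *: "(\<lambda>\<omega>. \<integral>u. \<psi> (G \<omega> u) \<partial>distr M borel V) \<in> borel_measurable A"
    by (intro D.borel_measurable_lebesgue_integral) (simp add: m)
  then have **: "(\<lambda>\<omega>. \<integral>u. \<psi> (G \<omega> u) \<partial>distr M borel V) \<in> borel_measurable M"
    using measurable_compose[OF id *] by simp
  then show "(\<lambda>\<omega>. \<integral>\<omega>'. \<psi> (G \<omega> (V \<omega>')) \<partial>M) \<in> borel_measurable M"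
    by (subst measurable_cong[OF inner[symmetric]])
  have int: "integrable (distr M A (\<lambda>\<omega>. \<omega>) \<Otimes>\<^sub>M distr M borel V) (\<lambda>(\<omega>, u). \<psi> (G \<omega> u))"
    using bound m by (intro P.integrable_const_bound[of _ B]) auto
  have "(\<integral>\<omega>. \<psi> (G \<omega> (V \<omega>)) \<partial>M) = (\<integral>\<omega>. (\<lambda>(\<omega>, u). \<psi> (G \<omega> u)) (\<omega>, V \<omega>) \<partial>M)"
    by simp
  also have "\<dots> = (\<integral>z. (\<lambda>(\<omega>, u). \<psi> (G \<omega> u)) z \<partial>distr M (A \<Otimes>\<^sub>M borel) (\<lambda>\<omega>. (\<omega>, V \<omega>)))"
    by (rule integral_distr[symmetric]) (auto simp: m)
  also have "\<dots> = (\<integral>\<omega>. (\<integral>u. \<psi> (G \<omega> u) \<partial>distr M borel V) \<partial>distr M A (\<lambda>\<omega>. \<omega>))"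
    unfolding distr_pair_indep_set[OF A V indep] using P.integral_fst'[OF int] by simp
  also have "\<dots> = (\<integral>\<omega>. (\<integral>u. \<psi> (G \<omega> u) \<partial>distr M borel V) \<partial>M)"
    by (rule integral_distr[OF id *])
  also have "\<dots> = (\<integral>\<omega>. (\<integral>\<omega>'. \<psi> (G \<omega> (V \<omega>')) \<partial>M) \<partial>M)"
    by (intro Bochner_Integration.integral_cong refl inner)
  finally show "(\<integral>\<omega>. (\<integral>\<omega>'. \<psi> (G \<omega> (V \<omega>')) \<partial>M) \<partial>M) = (\<integral>\<omega>. \<psi> (G \<omega> (V \<omega>)) \<partial>M)"
    by simp
qed

lemma (in prob_space) expectation_critic_distance_ge:
  fixes X :: "'a \<Rightarrow> real ^ 'd" and Y :: "'a \<Rightarrow> real ^ 'y" and Z :: "'a \<Rightarrow> real ^ 'z"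
  assumes X[measurable]: "X \<in> borel_measurable M" and Y[measurable]: "Y \<in> borel_measurable M"
    and Z[measurable]: "Z \<in> borel_measurable M"
    and G: "indep_random_function M G (\<lambda>\<omega>. (Z \<omega>, Y \<omega>))"
    and \<psi>[measurable]: "\<psi> \<in> borel_measurable borel" and bound: "\<And>x. \<bar>\<psi> x\<bar> \<le> B"
    and C: "\<And>\<sigma>. \<sigma> \<in> {-1, 1} \<Longrightarrow> (\<lambda>x. \<sigma> * \<psi> (fst x)) \<in> {f \<in> C. 1-lipschitz_on UNIV f}"
  shows "ennreal \<bar>(\<integral>\<omega>. \<psi> (G \<omega> (Z \<omega>, Y \<omega>)) \<partial>M) - (\<integral>\<omega>. \<psi> (X \<omega>) \<partial>M)\<bar>
    \<le> (\<integral>\<^sup>+\<omega>. e2ennreal (critic_distance M X Y Z C (G \<omega>)) \<partial>M)"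
proof -
  define I where "I \<omega> = (\<integral>\<omega>'. \<psi> (G \<omega> (Z \<omega>', Y \<omega>')) \<partial>M)" for \<omega>
  have V: "(\<lambda>\<omega>. (Z \<omega>, Y \<omega>)) \<in> borel_measurable M" by measurable
  have I[measurable]: "I \<in> borel_measurable M"
    and I_int: "(\<integral>\<omega>. I \<omega> \<partial>M) = (\<integral>\<omega>. \<psi> (G \<omega> (Z \<omega>, Y \<omega>)) \<partial>M)"
    unfolding I_def using integral_indep_random_function[OF G V \<psi> bound] by simp_all
  have "\<bar>I \<omega>\<bar> \<le> B" for \<omega>
  proof -
    have "0 \<le> B" using bound[of 0] by linarith
    then have "\<bar>I \<omega>\<bar> \<le> (\<integral>\<omega>'. \<bar>\<psi> (G \<omega> (Z \<omega>', Y \<omega>'))\<bar> \<partial>M)"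
      unfolding I_def by (intro integral_abs_bound)
    also have "\<dots> \<le> (\<integral>\<omega>'. B \<partial>M)"
      using bound \<open>0 \<le> B\<close> by (intro integral_mono_AE') auto
    finally show ?thesis by (simp add: prob_space)
  qed
  then have I_integrable: "integrable M I"
    by (intro integrable_const_bound[of _ B]) auto
  have pointwise: "ennreal \<bar>I \<omega> - (\<integral>\<omega>. \<psi> (X \<omega>) \<partial>M)\<bar> \<le> e2ennreal (critic_distance M X Y Z C (G \<omega>))" for \<omega>
  proof -
    have "ereal (\<sigma> * ((\<integral>\<omega>. \<psi> (X \<omega>) \<partial>M) - I \<omega>)) \<le> critic_distance M X Y Z C (G \<omega>)"
      if "\<sigma> \<in> {-1, 1}" for \<sigma>
      unfolding critic_distance_def I_def
      by (rule SUP_upper2[OF C[OF that]]) (simp add: right_diff_distrib)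
    from this[of 1] this[of "- 1"]
    have "ereal \<bar>I \<omega> - (\<integral>\<omega>. \<psi> (X \<omega>) \<partial>M)\<bar> \<le> critic_distance M X Y Z C (G \<omega>)"
      by (auto simp: abs_if)
    then show ?thesis
      using e2ennreal_mono by fastforce
  qed
  have "ennreal \<bar>(\<integral>\<omega>. \<psi> (G \<omega> (Z \<omega>, Y \<omega>)) \<partial>M) - (\<integral>\<omega>. \<psi> (X \<omega>) \<partial>M)\<bar>
      = ennreal \<bar>\<integral>\<omega>. I \<omega> - (\<integral>\<omega>. \<psi> (X \<omega>) \<partial>M) \<partial>M\<bar>"
    using I_integrable by (simp add: I_int prob_space)
  also have "\<dots> \<le> ennreal (\<integral>\<omega>. \<bar>I \<omega> - (\<integral>\<omega>. \<psi> (X \<omega>) \<partial>M)\<bar> \<partial>M)"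
    by (intro ennreal_leI integral_abs_bound)
  also have "\<dots> = (\<integral>\<^sup>+\<omega>. ennreal \<bar>I \<omega> - (\<integral>\<omega>. \<psi> (X \<omega>) \<partial>M)\<bar> \<partial>M)"
    using I_integrable by (intro nn_integral_eq_integral[symmetric]) auto
  also have "\<dots> \<le> (\<integral>\<^sup>+\<omega>. e2ennreal (critic_distance M X Y Z C (G \<omega>)) \<partial>M)"
    by (intro nn_integral_mono pointwise)
  finally show ?thesis .
qed

lemma relu_mult: "0 \<le> c \<Longrightarrow> relu (c * t) = c * relu t"
  by (auto simp: relu_def max_def zero_le_mult_iff mult_le_0_iff)

lemma bounded_unit_cube: "bounded (unit_cube :: (real ^ 'r) set)"
  by (rule bounded_subset[OF bounded_cbox[of 0 1]]) (auto simp: unit_cube_def mem_box_cart)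

lemma filterlim_times_rate_at_top:
  assumes "0 < \<gamma>" "0 < m"
  shows "filterlim (\<lambda>n. real n * rate \<gamma> m n) at_top sequentially"
proof -
  define q where "q = real m / (2 * \<gamma> + real m)"
  have "0 < q" using assms by (simp add: q_def)
  then have lim: "filterlim (\<lambda>n. exp (q * ln (real n))) at_top sequentially"
    by (intro filterlim_compose[OF exp_at_top] filterlim_tendsto_pos_mult_at_top[OF tendsto_const]
        filterlim_compose[OF ln_at_top] filterlim_real_sequentially)
  have "\<forall>\<^sub>F n in sequentially. exp (q * ln (real n)) = real n * rate \<gamma> m n"
    using eventually_gt_at_top[of 0]
  proof eventually_elim
    case (elim n)
    have "1 + - (2 * \<gamma>) / (2 * \<gamma> + real m) = q"
      using assms by (simp add: q_def field_simps)
    then have "real n powr q = real n * rate \<gamma> m n"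
      using elim powr_add[of "real n" 1 "- (2 * \<gamma>) / (2 * \<gamma> + real m)"] by (simp add: rate_def)
    then show ?case using elim by (simp add: powr_def)
  qed
  then show ?thesis
    by (rule iffD1[OF filterlim_cong[OF refl refl] lim])
qed

lemma eventually_critic_ramp:
  fixes w :: "real ^ 'd" and p :: "nat \<Rightarrow> nat \<Rightarrow> nat"
  assumes ab: "a < b" and gamma: "\<gamma> \<ge> 1"
    and ends: "\<forall>n\<ge>1. p n 0 = CARD('d) + CARD('y) \<and> p n (L n + 1) = 1"
    and F: "\<forall>n\<ge>1. F n \<ge> 1"
    and depth: "\<forall>n\<ge>1. real (L n) \<ge>
           log 2 (real n) * log 2 (max (4 * real (CARD('d) + CARD('y))) (4 * \<gamma>))"
    and width: "\<exists>c>0. \<forall>n\<ge>1. \<forall>i\<in>{1..L n}.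
           real (p n i) \<ge> c * (real n * rate \<gamma> (CARD('d) + CARD('y)) n)"
    and sparsity: "filterlim (\<lambda>n. s n - real (L n)) at_top sequentially"
  obtains c where "c > 0" and "\<forall>\<^sub>F n in sequentially. \<forall>\<sigma>\<in>{-1, 1}.
      (\<lambda>x :: (real ^ 'd) \<times> (real ^ 'y). \<sigma> * (c * (relu (fst x \<bullet> w - a) - relu (fst x \<bullet> w - b))))
        \<in> {f \<in> critic_networks (L n) (p n) (s n) (F n). 1-lipschitz_on UNIV f}"
proof
  let ?m = "CARD('d) + CARD('y)"
  define c where "c = 1 / (1 + norm w + 2 * \<bar>a\<bar> + 2 * \<bar>b\<bar>)"
  have pos: "0 < 1 + norm w + 2 * \<bar>a\<bar> + 2 * \<bar>b\<bar>"
    by (smt (verit) norm_ge_zero)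
  then show c: "0 < c" by (simp add: c_def)
  have c_le: "\<bar>c * t\<bar> \<le> 1" if "\<bar>t\<bar> \<le> 1 + norm w + 2 * \<bar>a\<bar> + 2 * \<bar>b\<bar>" for t
    using that pos by (simp add: c_def abs_mult)
  have bounds: "c * norm w \<le> 1" "\<bar>c * a\<bar> \<le> 1" "\<bar>c * b\<bar> \<le> 1" "c * b - c * a \<le> 1"
    using c_le[of a] c_le[of b] abs_le_D1[OF c_le[of "norm w"]] abs_le_D1[OF c_le[of "b - a"]]
      norm_ge_zero[of w] unfolding right_diff_distrib by linarith+
  have w': "norm (c *\<^sub>R w, 0 :: real ^ 'y) \<le> 1"
    using bounds(1) c by simp
  have scale: "(\<lambda>x. \<sigma> * (c * (relu (fst x \<bullet> w - a) - relu (fst x \<bullet> w - b)))) =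
      (\<lambda>x. \<sigma> * (relu (x \<bullet> (c *\<^sub>R w, 0 :: real ^ 'y) - c * a) - relu (x \<bullet> (c *\<^sub>R w, 0) - c * b)))"
    for \<sigma> :: real
  proof
    fix x :: "(real ^ 'd) \<times> (real ^ 'y)"
    have eq: "x \<bullet> (c *\<^sub>R w, 0 :: real ^ 'y) - c * t = c * (fst x \<bullet> w - t)" for t
      by (simp add: inner_prod_def right_diff_distrib)
    show "\<sigma> * (c * (relu (fst x \<bullet> w - a) - relu (fst x \<bullet> w - b))) =
        \<sigma> * (relu (x \<bullet> (c *\<^sub>R w, 0) - c * a) - relu (x \<bullet> (c *\<^sub>R w, 0) - c * b))"
      unfolding eq relu_mult[OF less_imp_le[OF c]] by (simp only: right_diff_distrib)
  qed
  have "1 \<le> CARD('d)" "1 \<le> CARD('y)"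
    by (simp_all add: Suc_le_eq)
  then have m2: "2 \<le> real ?m"
    by linarith
  obtain k where k: "k > 0" "\<And>n i. n \<ge> 1 \<Longrightarrow> i \<in> {1..L n} \<Longrightarrow>
      real (p n i) \<ge> k * (real n * rate \<gamma> ?m n)"
    using width by auto
  have "\<forall>\<^sub>F n in sequentially. real n * rate \<gamma> ?m n \<ge> 2 / k"
    using filterlim_times_rate_at_top[of \<gamma> ?m] gamma m2 by (simp add: filterlim_at_top)
  moreover have "\<forall>\<^sub>F n in sequentially. s n - real (L n) \<ge> real (2 * ?m + 3)"
    using sparsity unfolding filterlim_at_top by blast
  moreover have "\<forall>\<^sub>F n in sequentially. 4 \<le> n"
    by (rule eventually_ge_at_top)
  ultimately show "\<forall>\<^sub>F n in sequentially. \<forall>\<sigma>\<in>{-1, 1}.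
      (\<lambda>x :: (real ^ 'd) \<times> (real ^ 'y). \<sigma> * (c * (relu (fst x \<bullet> w - a) - relu (fst x \<bullet> w - b))))
        \<in> {f \<in> critic_networks (L n) (p n) (s n) (F n). 1-lipschitz_on UNIV f}"
  proof eventually_elim
    case (elim n)
    have n: "1 \<le> n" using elim by simp
    have log_4: "log 2 (4::real) = 2"
      using log_pow_cancel[of 2 2] by simp
    have "2 * 1 \<le> log 2 (real n) * log 2 (max (4 * real ?m) (4 * \<gamma>))"
    proof (rule mult_mono)
      show "2 \<le> log 2 (real n)"
        using elim log_4 log_mono[of 2 4 "real n"] by simp
      show "1 \<le> log 2 (max (4 * real ?m) (4 * \<gamma>))"
        using m2 log_mono[of 2 2 "max (4 * real ?m) (4 * \<gamma>)"] by simp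
    qed (use n in auto)
    also have "\<dots> \<le> real (L n)"
      using depth n by blast
    finally have L2: "2 \<le> L n"
      by simp
    have p2: "2 \<le> p n i" if "i \<in> {1..L n}" for i
    proof -
      have "2 \<le> k * (real n * rate \<gamma> ?m n)"
        using elim(1) k(1) by (simp add: pos_divide_le_eq mult.commute)
      then show ?thesis using k(2)[OF n that] by linarith
    qed
    show ?case
    proof (intro ballI)
      fix \<sigma> :: real assume \<sigma>: "\<sigma> \<in> {-1, 1}"
      show "(\<lambda>x :: (real ^ 'd) \<times> (real ^ 'y). \<sigma> * (c * (relu (fst x \<bullet> w - a) - relu (fst x \<bullet> w - b))))
        \<in> {f \<in> critic_networks (L n) (p n) (s n) (F n). 1-lipschitz_on UNIV f}"
        unfolding scale mem_Collect_eq
      proof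
        show "1-lipschitz_on UNIV (\<lambda>x :: (real ^ 'd) \<times> (real ^ 'y). \<sigma> *
            (relu (x \<bullet> (c *\<^sub>R w, 0) - c * a) - relu (x \<bullet> (c *\<^sub>R w, 0) - c * b)))"
          using \<sigma> ab c w' by (intro lipschitz_on_ramp) auto
        have "1 \<le> F n" using F n by blast
        then show "(\<lambda>x :: (real ^ 'd) \<times> (real ^ 'y). \<sigma> *
            (relu (x \<bullet> (c *\<^sub>R w, 0) - c * a) - relu (x \<bullet> (c *\<^sub>R w, 0) - c * b)))
            \<in> critic_networks (L n) (p n) (s n) (F n)"
        proof (intro critic_networks_ramp)
          show "1 \<le> p n i" if "i \<in> {1..L n}" for i
            using p2[OF that] by simp
          show "p n 0 = DIM((real ^ 'd) \<times> (real ^ 'y))"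
            using ends n by simp
          show "real (L n + 2 * p n 0 + 3) \<le> s n"
            using ends n elim(2) by simp
          show "c * a \<le> c * b" "\<bar>\<sigma>\<bar> \<le> 1"
            using c ab \<sigma> by auto
          show "p n (L n + 1) = 1" "2 \<le> p n 1"
            using ends n p2[of 1] L2 by auto
          show "c * b - c * a \<le> F n"
            using bounds(4) \<open>1 \<le> F n\<close> by linarith
        qed (use L2 w' bounds in simp_all)
      qed
    qed
  qed
qed

theorem lemma4p2:
  fixes M :: "'w measure"
    and X :: "'w \<Rightarrow> real ^ 'd" and Y :: "'w \<Rightarrow> real ^ 'y" and Z :: "'w \<Rightarrow> real ^ 'z"
    and gstar :: "(real ^ 'z) \<times> (real ^ 'y) \<Rightarrow> real ^ 'd"
    and ghat :: "nat \<Rightarrow> 'w \<Rightarrow> (real ^ 'z) \<times> (real ^ 'y) \<Rightarrow> real ^ 'd"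
    and \<beta> K \<gamma> :: real
    and L\<^sub>f :: "nat \<Rightarrow> nat" and p\<^sub>f :: "nat \<Rightarrow> nat \<Rightarrow> nat" and s\<^sub>f F :: "nat \<Rightarrow> real"
  assumes "prob_space M"
    and "X \<in> borel_measurable M" and "\<forall>\<omega>\<in>space M. X \<omega> \<in> unit_cube"
    and "Y \<in> borel_measurable M" and "\<forall>\<omega>\<in>space M. Y \<omega> \<in> unit_cube"
    and "Z \<in> borel_measurable M" and "\<forall>\<omega>\<in>space M. Z \<omega> \<in> unit_cube"
    and "indep_rvs M Z Y"
    and "\<beta> \<ge> 1" and "K > 0"
    and "gstar \<in> enc_dec_class TYPE('D::finite) TYPE('g::finite) \<beta> K"
    and "distr M borel (\<lambda>\<omega>. (X \<omega>, Y \<omega>)) = distr M borel (\<lambda>\<omega>. (gstar (Z \<omega>, Y \<omega>), Y \<omega>))"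
    and "\<gamma> \<ge> 1"
    and "\<forall>n\<ge>1. p\<^sub>f n 0 = CARD('d) + CARD('y) \<and> p\<^sub>f n (L\<^sub>f n + 1) = 1"
    and "\<forall>n\<ge>1. s\<^sub>f n > 0"
    and "\<forall>n\<ge>1. F n \<ge> 1"
    and "\<forall>n\<ge>1. real (L\<^sub>f n) \<ge>
           log 2 (real n) * log 2 (max (4 * real (CARD('d) + CARD('y))) (4 * \<gamma>))"
    and "\<exists>c>0. \<forall>n\<ge>1. \<forall>i\<in>{1..L\<^sub>f n}.
           real (p\<^sub>f n i) \<ge> c * (real n * rate \<gamma> (CARD('d) + CARD('y)) n)"
    and "\<exists>c>0. \<forall>n\<ge>1.
           s\<^sub>f n \<ge> c * (ln (real n) * real n * rate \<gamma> (CARD('d) + CARD('y)) n)"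
    and "filterlim (\<lambda>n. s\<^sub>f n - real (L\<^sub>f n)) at_top sequentially"
    and "\<forall>n. indep_random_function M (ghat n) (\<lambda>\<omega>. (Z \<omega>, Y \<omega>))"
    and "(\<lambda>n. \<integral>\<^sup>+\<omega>. e2ennreal
             (critic_distance M X Y Z (critic_networks (L\<^sub>f n) (p\<^sub>f n) (s\<^sub>f n) (F n)) (ghat n \<omega>)) \<partial>M)
           \<longlonglongrightarrow> 0"
  shows "conv_in_distribution M (\<lambda>n \<omega>. ghat n \<omega> (Z \<omega>, Y \<omega>)) (\<lambda>\<omega>. gstar (Z \<omega>, Y \<omega>)) \<and>
         distr M borel (\<lambda>\<omega>. gstar (Z \<omega>, Y \<omega>)) = distr M borel X"
proof
  note [measurable] = assms(2,4,6)
  note X_cube = assms(3) and gstar = assms(11) and law = assms(12)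
    and indep = assms(21) and conv = assms(22)
  interpret prob_space M by fact
  have [measurable]: "gstar \<in> borel_measurable borel"
    using gstar by (simp add: enc_dec_class_def)
  have ZY[measurable]: "(\<lambda>\<omega>. (Z \<omega>, Y \<omega>)) \<in> borel_measurable M"
    by measurable
  have gZY[measurable]: "(\<lambda>\<omega>. gstar (Z \<omega>, Y \<omega>)) \<in> borel_measurable M"
    using measurable_compose[OF ZY \<open>gstar \<in> borel_measurable borel\<close>] .
  have [measurable]: "(fst :: (real ^ 'd) \<times> (real ^ 'y) \<Rightarrow> _) \<in> borel_measurable borel"
    by (intro borel_measurable_continuous_onI continuous_intros)
  have "distr M borel X = distr (distr M borel (\<lambda>\<omega>. (X \<omega>, Y \<omega>))) borel fst"
    by (subst distr_distr) (auto simp: comp_def)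
  also have "\<dots> = distr M borel (\<lambda>\<omega>. gstar (Z \<omega>, Y \<omega>))"
    unfolding law by (subst distr_distr) (auto simp: comp_def)
  finally show same_law: "distr M borel (\<lambda>\<omega>. gstar (Z \<omega>, Y \<omega>)) = distr M borel X" ..
  have V[measurable]: "(\<lambda>\<omega>. ghat n \<omega> (Z \<omega>, Y \<omega>)) \<in> borel_measurable M" for n
    using indep indep_random_function_measurable(1)[OF _ ZY] by blast
  have "conv_in_distribution M (\<lambda>n \<omega>. ghat n \<omega> (Z \<omega>, Y \<omega>)) X"
  proof (rule conv_in_distribution_Cramer_Wold)
    show "bounded (X ` space M)"
      using X_cube by (intro bounded_subset[OF bounded_unit_cube]) auto
    fix w :: "real ^ 'd"
    show "weak_conv_m (\<lambda>n. distr M borel (\<lambda>\<omega>. ghat n \<omega> (Z \<omega>, Y \<omega>) \<bullet> w))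
        (distr M borel (\<lambda>\<omega>. X \<omega> \<bullet> w))"
    proof (rule integral_cts_step_conv_imp_weak_conv)
      fix a b :: real assume ab: "a < b"
      obtain c where c: "c > 0" and critic: "\<forall>\<^sub>F n in sequentially. \<forall>\<sigma>\<in>{-1, 1}.
          (\<lambda>x :: (real ^ 'd) \<times> (real ^ 'y). \<sigma> * (c * (relu (fst x \<bullet> w - a) - relu (fst x \<bullet> w - b))))
            \<in> {f \<in> critic_networks (L\<^sub>f n) (p\<^sub>f n) (s\<^sub>f n) (F n). 1-lipschitz_on UNIV f}"
        by (rule eventually_critic_ramp[OF ab assms(13,14,16,17,18,20)])
      define \<psi> where "\<psi> x = c * (relu (x \<bullet> w - a) - relu (x \<bullet> w - b))" for x
      have [measurable]: "\<psi> \<in> borel_measurable borel"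
        unfolding \<psi>_def relu_def by measurable
      have bound: "\<bar>\<psi> x\<bar> \<le> c * (b - a)" for x
        using relu_ramp_bounds[of a b "x \<bullet> w"] ab c by (auto simp: \<psi>_def abs_mult)
      have "\<forall>\<^sub>F n in sequentially. ennreal \<bar>(\<integral>\<omega>. \<psi> (ghat n \<omega> (Z \<omega>, Y \<omega>)) \<partial>M) - (\<integral>\<omega>. \<psi> (X \<omega>) \<partial>M)\<bar>
          \<le> (\<integral>\<^sup>+\<omega>. e2ennreal
             (critic_distance M X Y Z (critic_networks (L\<^sub>f n) (p\<^sub>f n) (s\<^sub>f n) (F n)) (ghat n \<omega>)) \<partial>M)"
        using critic
      proof eventually_elim
        case (elim n)
        show ?case
        proof (rule expectation_critic_distance_ge)
          show "(\<lambda>x :: (real ^ 'd) \<times> (real ^ 'y). \<sigma> * \<psi> (fst x))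
              \<in> {f \<in> critic_networks (L\<^sub>f n) (p\<^sub>f n) (s\<^sub>f n) (F n). 1-lipschitz_on UNIV f}"
            if "\<sigma> \<in> {-1, 1}" for \<sigma>
            using elim that unfolding \<psi>_def by blast
        qed (use indep bound in simp_all)
      qed
      then have "(\<lambda>n. ennreal \<bar>(\<integral>\<omega>. \<psi> (ghat n \<omega> (Z \<omega>, Y \<omega>)) \<partial>M) - (\<integral>\<omega>. \<psi> (X \<omega>) \<partial>M)\<bar>) \<longlonglongrightarrow> 0"
        by (intro tendsto_sandwich[OF _ _ tendsto_const conv]) auto
      then have "(\<lambda>n. \<bar>(\<integral>\<omega>. \<psi> (ghat n \<omega> (Z \<omega>, Y \<omega>)) \<partial>M) - (\<integral>\<omega>. \<psi> (X \<omega>) \<partial>M)\<bar>) \<longlonglongrightarrow> 0"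
        by (subst (asm) ennreal_0[symmetric], subst (asm) tendsto_ennreal_iff) auto
      then have \<psi>_conv: "(\<lambda>n. \<integral>\<omega>. \<psi> (ghat n \<omega> (Z \<omega>, Y \<omega>)) \<partial>M) \<longlonglongrightarrow> (\<integral>\<omega>. \<psi> (X \<omega>) \<partial>M)"
        by (simp only: tendsto_rabs_zero_iff LIM_zero_iff)
      have step: "integral\<^sup>L (distr M borel (\<lambda>\<omega>. W \<omega> \<bullet> w)) (cts_step a b) =
          1 - (\<integral>\<omega>. \<psi> (W \<omega>) \<partial>M) / (c * (b - a))" if [measurable]: "W \<in> borel_measurable M" for W
      proof -
        have [measurable]: "cts_step a b \<in> borel_measurable borel"
          unfolding cts_step_def[abs_def] by measurable
        have "integrable M (\<lambda>\<omega>. \<psi> (W \<omega>))"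
          using bound by (intro integrable_const_bound[of _ "c * (b - a)"]) auto
        moreover have "cts_step a b (W \<omega> \<bullet> w) = 1 - \<psi> (W \<omega>) / (c * (b - a))" for \<omega>
          using c ab by (simp add: \<psi>_def relu_ramp)
        ultimately show ?thesis
          by (simp add: integral_distr prob_space)
      qed
      show "(\<lambda>n. integral\<^sup>L (distr M borel (\<lambda>\<omega>. ghat n \<omega> (Z \<omega>, Y \<omega>) \<bullet> w)) (cts_step a b))
          \<longlonglongrightarrow> integral\<^sup>L (distr M borel (\<lambda>\<omega>. X \<omega> \<bullet> w)) (cts_step a b)"
        unfolding step[OF V] step[OF assms(2)] using c ab by (intro tendsto_intros \<psi>_conv) auto
    qed auto
  qed auto
  moreover have "(\<integral>\<omega>. \<phi> (gstar (Z \<omega>, Y \<omega>)) \<partial>M) = (\<integral>\<omega>. \<phi> (X \<omega>) \<partial>M)"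
    if "continuous_on UNIV \<phi>" for \<phi> :: "real ^ 'd \<Rightarrow> real"
  proof -
    have [measurable]: "\<phi> \<in> borel_measurable borel"
      using that by (rule borel_measurable_continuous_onI)
    have "(\<integral>\<omega>. \<phi> (gstar (Z \<omega>, Y \<omega>)) \<partial>M) = integral\<^sup>L (distr M borel (\<lambda>\<omega>. gstar (Z \<omega>, Y \<omega>))) \<phi>"
      by (simp add: integral_distr)
    also have "\<dots> = (\<integral>\<omega>. \<phi> (X \<omega>) \<partial>M)"
      unfolding same_law by (simp add: integral_distr)
    finally show ?thesis .
  qed
  ultimately show "conv_in_distribution M (\<lambda>n \<omega>. ghat n \<omega> (Z \<omega>, Y \<omega>)) (\<lambda>\<omega>. gstar (Z \<omega>, Y \<omega>))"
    by (simp add: conv_in_distribution_def)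
qed

end
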